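(* Let $\omega$ be a factor of the Fibonacci sequence $F_\infty$ with $\omega\notin\{\varepsilon,ab,ba,aba\}$, let $n=|\omega|$, let $k\ge0$ be the integer with $f_k\le n<f_{k+1}$, and let $\omega=\mu_1(\omega)\,sk(\omega)\,\mu_2(\omega)$ be its singular decomposition. (1) If $\omega\in\mathrm{T}1.1$, then $\mu_1(\omega)=\mu_2(\omega)=\varepsilon$. (2) If $\omega\in\mathrm{T}1.2$, then there is an integer $i$ with $f_{k-1}-1\le i\le f_k-1$ such that $\mu_1(\omega)=s_{k-2}[i-f_{k-1}+2,f_{k-2}]$ and $\mu_2(\omega)=s_{k-2}[1,i-f_{k-1}+1]$. (3) If $\omega\in\mathrm{T}1.3$, then there is an integer $i$ with $0\le i\le f_{k-1}-2$ such that $\mu_1(\omega)=s_{k-1}[i+2,f_{k-1}]$ and $\mu_2(\omega)=s_{k-1}[1,i+1]$. (4) If $\omega\in\mathrm{T}2.1$, then there is an integer $i$ with $0\le i\le n-f_k$ such that $\mu_1(\omega)=s_{k-1}[f_{k-1}-i+1,f_{k-1}]$ and $\mu_2(\omega)=s_{k-1}[1,n-f_k-i]$. (5) If $\omega\in\mathrm{T}2.2$, then there is an integer $i$ with $0\le i\le n-f_{k-1}$ such that $\mu_1(\omega)=s_k[f_k-i+1,f_k]$ and $\mu_2(\omega)=s_k[1,n-f_{k-1}-i]$. (6) If $\omega\in\mathrm{T}2.3$, then there is an integer $i$ with $0\le i\le f_{k+1}-n-2$ such that $\mu_1(\omega)=s_{k-1}[f_{k+1}-n-i,f_{k-1}]$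 and $\mu_2(\omega)=s_{k-1}[1,f_{k-1}-i-1]$.
   Context: Words are over $\{a,b\}$; $\varepsilon$ is the empty word, $|\omega|$ is the length. Let $\sigma(a)=ab$, $\sigma(b)=a$, $F_k=\sigma^k(a)$ for $k\ge0$, and $F_\infty=\lim_{k\to\infty}F_k$ (Fibonacci sequence). Let $f_{-1}=f_0=1$, $f_{k+1}=f_k+f_{k-1}$, so $|F_k|=f_k$. For $k\ge0$ let $\alpha$ be the last letter of $F_k$ and $\beta$ the other letter. The singular words are $s_{-1}=a$ and $s_k=\beta F_k\alpha^{-1}$ for $k\ge0$ (delete the last letter of $F_k$ and prepend $\beta$); $|s_k|=f_k$. For a word $\tau=x_1x_2\cdots$, $\tau[i,j]=x_i\cdots x_j$ and $\tau[i,i-1]=\varepsilon$. Only for evaluating formulas when $k=0$, put $f_{-2}=0$ and $s_{-2}=\varepsilon$ (this $s_{-2}$ is not counted as a singular word). The singular kernel $sk(\omega)$ is the longest singular word that is a factor of $\omega$; for a factor $\omega\notin\{\varepsilon,ab,ba,aba\}$ of $F_\infty$ it is well defined and occurs exactly once in $\omega$, so $\omega=\mu_1(\omega)\,sk(\omega)\,\mu_2(\omega)$ for uniquely determined words $\mu_1(\omega),\mu_2(\omega)$ (the singular decomposition). Types: for a factor $\omega\notin\{\varepsilon,ab,ba,aba\}$ of $F_\infty$ let $k\ge0$ be the unique integer with $f_k\le|\omega|<f_{k+1}$. Then $\omega\in\mathrm{T}1.j$ iff $|\omega|=f_k$ and $sk(\omega)=s_{k-j+1}$, and $\omega\in\mathrm{T}2.j$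 iff $f_k<|\omega|<f_{k+1}$ and $sk(\omega)=s_{k-j+1}$, for $j=1,2,3$ (for $j=3$ only $k\ge1$ is considered). *)

theory Defs
  imports Complex_Main "HOL-Library.Sublist" "HOL-Number_Theory.Fib"
begin

datatype letter = La | Lb

type_synonym word = "letter list"

fun other :: "letter \<Rightarrow> letter" where
  "other La = Lb"
| "other Lb = La"

fun sigma_letter :: "letter \<Rightarrow> word" where
  "sigma_letter La = [La, Lb]"
| "sigma_letter Lb = [La]"

definition sigma :: "word \<Rightarrow> word" where
  "sigma w = concat (map sigma_letter w)"

definition Fw :: "nat \<Rightarrow> word" where
  "Fw k = (sigma ^^ k) [La]"

text \<open>The letterwise limit of the words \<open>Fw k\<close>; lemma \<open>Finf_nth\<close> below shows that it exists.
  Positions in the infinite word are counted from \<open>0\<close>.\<close>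

definition Finf :: "nat \<Rightarrow> letter" where
  "Finf i = (THE c. \<forall>\<^sub>F k in sequentially. i < length (Fw k) \<and> Fw k ! i = c)"

definition Fib_factor :: "word \<Rightarrow> bool" where
  "Fib_factor w \<longleftrightarrow> (\<exists>p. w = map Finf [p..<p + length w])"

text \<open>The Fibonacci numbers are normalised by \<open>f (-2) = 0\<close>, \<open>f (-1) = f 0 = 1\<close>, which is a shift
  by two of the library function \<open>fib\<close>. The index is an integer, and only indices from \<open>-2\<close> on
  are meaningful.\<close>

definition fibnum :: "int \<Rightarrow> int" where
  "fibnum k = int (fib (nat (k + 2)))"

text \<open>For \<open>k \<ge> 0\<close> this is the word obtained from \<open>Fw k\<close> by deleting the last letter and
  prepending the letter different from it. The value at \<open>-2\<close> is the convention
  \<open>s (-2) = \<epsilon>\<close>, which is not a singular word.\<close>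

definition sing_word :: "int \<Rightarrow> word" where
  "sing_word k =
    (if k \<ge> 0 then other (last (Fw (nat k))) # butlast (Fw (nat k))
     else if k = -1 then [La] else [])"

definition singular :: "word \<Rightarrow> bool" where
  "singular w \<longleftrightarrow> (\<exists>k\<ge>-1. w = sing_word k)"

text \<open>\<open>subword w i j\<close> is \<open>w[i,j]\<close>, with positions counted from \<open>1\<close>, for
  \<open>1 \<le> i \<le> j + 1\<close> and \<open>j \<le> |w|\<close>; it is empty for \<open>j = i - 1\<close>.\<close>

definition subword :: "word \<Rightarrow> int \<Rightarrow> int \<Rightarrow> word" where
  "subword w i j = drop (nat (i - 1)) (take (nat j) w)"

definition exceptional :: "word set" where
  "exceptional = {[], [La, Lb], [Lb, La], [La, Lb, La]}"

definition sk :: "word \<Rightarrow> word" where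
  "sk w = (THE s. singular s \<and> sublist s w \<and>
             (\<forall>t. singular t \<and> sublist t w \<longrightarrow> length t \<le> length s))"

definition sing_decomp :: "word \<Rightarrow> word \<times> word" where
  "sing_decomp w = (THE (u, v). w = u @ sk w @ v)"

definition mu1 :: "word \<Rightarrow> word" where
  "mu1 w = fst (sing_decomp w)"

definition mu2 :: "word \<Rightarrow> word" where
  "mu2 w = snd (sing_decomp w)"

text \<open>The integer \<open>k\<close> in the two definitions of types is determined by the length of the word,
  since \<open>fibnum\<close> is strictly increasing on the nonnegative integers.\<close>

definition T1 :: "int \<Rightarrow> word set" where
  "T1 j = {w. Fib_factor w \<and> w \<notin> exceptional \<and> j \<in> {1, 2, 3} \<and>
             (\<exists>k\<ge>0. fibnum k \<le> int (length w) \<and> int (length w) < fibnum (k + 1) \<and>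
                (j = 3 \<longrightarrow> k \<ge> 1) \<and>
                int (length w) = fibnum k \<and> sk w = sing_word (k - j + 1))}"

definition T2 :: "int \<Rightarrow> word set" where
  "T2 j = {w. Fib_factor w \<and> w \<notin> exceptional \<and> j \<in> {1, 2, 3} \<and>
             (\<exists>k\<ge>0. fibnum k \<le> int (length w) \<and> int (length w) < fibnum (k + 1) \<and>
                (j = 3 \<longrightarrow> k \<ge> 1) \<and>
                fibnum k < int (length w) \<and> sk w = sing_word (k - j + 1))}"

lemma fibnum_initial: "fibnum (-2) = 0" "fibnum (-1) = 1" "fibnum 0 = 1"
  by (simp_all add: fibnum_def numeral_2_eq_2)

lemma fibnum_rec:
  assumes "k \<ge> -1"
  shows "fibnum (k + 1) = fibnum k + fibnum (k - 1)"
proof -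
  define m where "m = nat (k + 1)"
  have "nat (k + 1 + 2) = Suc (Suc m)" "nat (k + 2) = Suc m" "nat (k - 1 + 2) = m"
    using assms by (auto simp: m_def)
  then show ?thesis by (simp add: fibnum_def)
qed

lemma Fw_Suc_Suc: "Fw (Suc (Suc k)) = Fw (Suc k) @ Fw k"
proof (induction k)
  case 0
  show ?case by (simp add: Fw_def sigma_def)
next
  case (Suc k)
  have "Fw (Suc (Suc (Suc k))) = sigma (Fw (Suc (Suc k)))" by (simp add: Fw_def)
  also have "\<dots> = sigma (Fw (Suc k)) @ sigma (Fw k)" by (simp add: Suc sigma_def)
  finally show ?case by (simp add: Fw_def)
qed

lemma length_Fw_nat: "length (Fw k) = fib (Suc (Suc k))"
proof (induction k rule: fib.induct)
  case 1
  show ?case by (simp add: Fw_def)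
next
  case 2
  show ?case by (simp add: Fw_def sigma_def)
next
  case (3 k)
  then show ?case by (simp add: Fw_Suc_Suc)
qed

lemma length_Fw: "int (length (Fw k)) = fibnum (int k)"
proof -
  have "nat (int k + 2) = Suc (Suc k)" by simp
  then show ?thesis by (simp add: length_Fw_nat fibnum_def del: fib.simps)
qed

lemma prefix_Fw:
  assumes "k \<le> m"
  shows "prefix (Fw k) (Fw m)"
  using assms
proof (induction m rule: dec_induct)
  case base
  show ?case by simp
next
  case (step m)
  have "prefix (Fw m) (Fw (Suc m))"
  proof (cases m)
    case 0
    then show ?thesis by (simp add: Fw_def sigma_def)
  next
    case (Suc l)
    then show ?thesis by (simp add: Fw_Suc_Suc)
  qed
  with step show ?case using prefix_order.trans by blast
qed

lemma Finf_nth: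
  assumes "i < length (Fw k)"
  shows "Finf i = Fw k ! i"
proof -
  have *: "i < length (Fw m) \<and> Fw m ! i = Fw k ! i" if "k \<le> m" for m
    using prefix_Fw[OF that] assms by (auto simp: prefix_def nth_append)
  show ?thesis unfolding Finf_def
  proof (rule the_equality)
    show "\<forall>\<^sub>F m in sequentially. i < length (Fw m) \<and> Fw m ! i = Fw k ! i"
      unfolding eventually_sequentially using * by blast
  next
    fix c
    assume "\<forall>\<^sub>F m in sequentially. i < length (Fw m) \<and> Fw m ! i = c"
    then obtain N where "\<And>m. N \<le> m \<Longrightarrow> Fw m ! i = c"
      unfolding eventually_sequentially by blast
    from this[of "max N k"] *[of "max N k"] show "c = Fw k ! i" by simp
  qed
qed

end

theory Submission
  imports Defs
begin

text \<open>Let \<open>s\<^sub>m\<close> be the singular kernel of \<open>w = u s\<^sub>m v\<close>. All six parts follow from one fact: \<open>u\<close> is a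
  proper suffix and \<open>v\<close> a proper prefix of the next singular word \<open>s\<^sub>m\<^sub>+\<^sub>1\<close>. Given this, the length of
  \<open>w\<close> fixes \<open>|u| + |v|\<close>, and the integer \<open>i\<close> of the statement is \<open>|u|\<close> or \<open>|v|\<close> up to a shift
  or a reflection. The bounds on \<open>i\<close> express that lengths are nonnegative or that the affixes are
  proper. Where only \<open>s\<^sub>m\<^sub>-\<^sub>1\<close> is named, the affixes are short enough to lie in the prefix and the
  suffix \<open>s\<^sub>m\<^sub>-\<^sub>1\<close> of \<open>s\<^sub>m\<^sub>+\<^sub>1\<close> (\<open>S_affixes\<close>).

  The fact itself rests on the rigidity of the surroundings of \<open>s\<^sub>m\<close> in the Fibonacci sequence:
  up to the ends of the factor, every occurrence of \<open>s\<^sub>m\<close> is preceded by \<open>s\<^sub>m\<^sub>+\<^sub>1\<close> without its first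
  letter and followed by \<open>s\<^sub>m\<^sub>+\<^sub>1\<close> without its last letter (\<open>S_context\<close>). If \<open>v\<close> goes beyond that, its
  next letter either completes \<open>s\<^sub>m\<^sub>+\<^sub>1\<close>, or it is the other letter, and then \<open>v\<close> begins with
  \<open>s\<^sub>m\<^sub>-\<^sub>1 s\<^sub>m\<close> (\<open>S_flip_last\<close>), so that \<open>w\<close> contains \<open>s\<^sub>m s\<^sub>m\<^sub>-\<^sub>1 s\<^sub>m = s\<^sub>m\<^sub>+\<^sub>2\<close>. Both contradict the
  maximality of \<open>s\<^sub>m\<close>, and the left side is symmetric (\<open>affixes_of_maximal_S\<close>).

  The rigidity is trivial for \<open>s\<^sub>-\<^sub>1 = a\<close> and is propagated by the morphism. Occurrences of
  \<open>s\<^sub>m\<^sub>+\<^sub>1\<close> in \<open>\<sigma>(z)a\<close> correspond to occurrences of \<open>s\<^sub>m\<close> in \<open>z\<close>, because \<open>\<sigma>(s\<^sub>m)a\<close> is \<open>s\<^sub>m\<^sub>+\<^sub>1\<close> or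
  \<open>a s\<^sub>m\<^sub>+\<^sub>1 a\<close>, according to the parity of \<open>m\<close>, and because \<open>\<sigma>(z)a\<close> can be cut in only one way, before
  each letter \<open>a\<close> (\<open>desubstitute_S\<close>). The same descent shows that \<open>s\<^sub>m\<close> occurs only once in the word
  made of its two forced neighbours and itself, hence only once in \<open>w\<close>, so the decomposition is
  unique.\<close>

section \<open>Factors of the Fibonacci sequence and the morphism\<close>

lemma sigma_simps [simp]:
  "sigma [] = []"
  "sigma (c # w) = sigma_letter c @ sigma w"
  "sigma (v @ w) = sigma v @ sigma w"
  by (simp_all add: sigma_def)

lemma Fw_Suc: "Fw (Suc k) = sigma (Fw k)"
  by (simp add: Fw_def)

lemma Fw_0: "Fw 0 = [La]"
  by (simp add: Fw_def)

lemma Fw_nonempty [simp]: "Fw k \<noteq> []"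
  using prefix_Fw[of 0 k] by (auto simp: Fw_0)

lemma le_Suc_fib: "n \<le> Suc (fib n)"
proof (induction n rule: fib.induct)
  case (3 n)
  then show ?case by (cases n rule: fib.cases) (auto simp: fib_neq_0_nat)
qed simp_all

lemma Fw_eq_map_Finf: "Fw k = map Finf [0..<length (Fw k)]"
  by (rule nth_equalityI) (simp_all add: Finf_nth)

lemma Fib_factor_iff_sublist_Fw: "Fib_factor w \<longleftrightarrow> (\<exists>k. sublist w (Fw k))"
proof
  assume "Fib_factor w"
  then obtain p where p: "w = map Finf [p..<p + length w]"
    unfolding Fib_factor_def by blast
  define k where "k = Suc (p + length w)"
  have "p + length w \<le> length (Fw k)"
    using le_Suc_fib[of "Suc (Suc k)"] unfolding length_Fw_nat k_def by linarith
  then have "map Finf [p..<p + length w] = take (length w) (drop p (Fw k))"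
    by (subst Fw_eq_map_Finf) (simp add: drop_map take_map)
  then have "sublist w (Fw k)"
    using p by (metis sublist_take sublist_drop sublist_order.order_trans)
  then show "\<exists>k. sublist w (Fw k)" ..
next
  assume "\<exists>k. sublist w (Fw k)"
  then obtain k x y where "Fw k = x @ w @ y" by (auto simp: sublist_def)
  then have eq: "map Finf [0..<length x + length w + length y] = x @ w @ y"
    using Fw_eq_map_Finf[of k] by (simp add: add.assoc)
  have "w = take (length w) (drop (length x) (x @ w @ y))" by simp
  also have "\<dots> = map Finf [length x..<length x + length w]"
    unfolding eq[symmetric] by (simp add: drop_map take_map)
  finally show "Fib_factor w" unfolding Fib_factor_def by blast
qed

text \<open>The trailing letter \<open>a\<close> costs nothing, since every image \<open>\<sigma>(c)\<close> begins with \<open>a\<close>. It makes the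
  right end of the parsing in the next section uniform.\<close>

lemma Fib_factor_in_sigma:
  assumes "Fib_factor w"
  obtains z x y where "Fib_factor z" "x @ w @ y = sigma z @ [La]"
proof -
  obtain k where "sublist w (Fw k)"
    using assms by (auto simp: Fib_factor_iff_sublist_Fw)
  then have "sublist w (sigma (Fw k))"
    using prefix_Fw[of k "Suc k"]
    by (metis Fw_Suc le_Suc_eq order_refl prefix_imp_sublist sublist_order.order_trans)
  then obtain x y where "sigma (Fw k) = x @ w @ y" by (auto simp: sublist_def)
  moreover have "Fib_factor (Fw k)" by (auto simp: Fib_factor_iff_sublist_Fw)
  ultimately show thesis using that[of "Fw k" x "y @ [La]"] by simp
qed

section \<open>Desubstitution\<close>

lemma sigma_La_begins: "\<exists>y. sigma z @ [La] = La # y"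
  by (cases z; cases "hd z") auto

lemma Lb_isolated:
  assumes "sigma z @ [La] = u @ Lb # v"
  shows "\<exists>u' v'. u = u' @ [La] \<and> v = La # v'"
  using assms
proof (induction z arbitrary: u)
  case Nil
  then show ?case by (auto simp: append_eq_Cons_conv Cons_eq_append_conv)
next
  case (Cons c z)
  obtain y where y: "sigma z @ [La] = La # y" using sigma_La_begins by blast
  show ?case
  proof (cases c)
    case La
    with Cons.prems have "La # Lb # sigma z @ [La] = u @ Lb # v" by simp
    then consider "u = [La]" "v = sigma z @ [La]"
      | u' where "u = La # Lb # u'" "sigma z @ [La] = u' @ Lb # v"
      by (auto simp: Cons_eq_append_conv)
    then show ?thesis
    proof cases
      case 1
      then show ?thesis using y by simp
    next
      case 2
      then show ?thesis using Cons.IH[of u'] by auto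
    qed
  next
    case Lb
    with Cons.prems obtain u' where "u = La # u'" "sigma z @ [La] = u' @ Lb # v"
      by (auto simp: Cons_eq_append_conv)
    then show ?thesis using Cons.IH by fastforce
  qed
qed

text \<open>The images \<open>ab\<close> and \<open>a\<close> of the letters are told apart by the letter after their first one,
  and the letter \<open>a\<close> after \<open>\<sigma>(t)\<close> on both sides makes this test available for the last letter too.\<close>

lemma desubstitute_prefix:
  assumes "sigma z @ [La] = sigma t @ La # Y"
  shows "\<exists>z2. z = t @ z2 \<and> sigma z2 @ [La] = La # Y"
  using assms
proof (induction t arbitrary: z)
  case Nil
  then show ?case by simp
next
  case (Cons c t)
  show ?case
  proof (cases z)
    case Nil
    with Cons.prems show ?thesis by (cases c) auto
  next
    case (Cons d z')
    have "d = c"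
    proof (cases c; cases d)
      assume "c = La" "d = Lb"
      with Cons.prems Cons show ?thesis using sigma_La_begins[of z'] by auto
    next
      assume "c = Lb" "d = La"
      with Cons.prems Cons show ?thesis
        by (cases t; cases "hd t") auto
    qed auto
    with Cons Cons.prems Cons.IH[of z'] show ?thesis by auto
  qed
qed

lemma desubstitute:
  assumes "sigma z @ [La] = X @ sigma t @ La # Y"
  shows "\<exists>z1 z2. z = z1 @ t @ z2 \<and> X = sigma z1 \<and> sigma z2 @ [La] = La # Y"
  using assms
proof (induction z arbitrary: X)
  case Nil
  have "length X + length (sigma t) + length Y = 0"
    using arg_cong[OF Nil, of length] by simp
  moreover have "t = []" if "sigma t = []"
    using that by (cases t; cases "hd t") auto
  ultimately show ?case by simp
next
  case (Cons c z)
  show ?case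
  proof (cases "X = []")
    case True
    with Cons.prems have "sigma (c # z) @ [La] = sigma t @ La # Y" by simp
    from desubstitute_prefix[OF this] True show ?thesis
      by (metis append_Nil sigma_simps(1))
  next
    case False
    obtain y where y: "sigma t @ La # Y = La # y"
      by (cases t; cases "hd t") auto
    have "\<exists>X'. X = sigma_letter c @ X'"
      using Cons.prems False unfolding y
      by (cases c) (auto simp: Cons_eq_append_conv)
    then obtain X' where X: "X = sigma_letter c @ X'" by blast
    with Cons.prems have "sigma z @ [La] = X' @ sigma t @ La # Y" by simp
    then obtain z1 z2 where "z = z1 @ t @ z2" "X' = sigma z1" "sigma z2 @ [La] = La # Y"
      using Cons.IH by blast
    with X show ?thesis by (intro exI[of _ "c # z1"] exI[of _ z2]) simp
  qed
qed

section \<open>Singular words\<close>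

text \<open>The shift by two turns the index into a natural number that starts at the convention
  \<open>s\<^sub>-\<^sub>2 = \<epsilon>\<close>, and makes \<open>fib n\<close> the length of \<open>S n\<close>. The singular words are those with \<open>n \<ge> 1\<close>.\<close>

definition S :: "nat \<Rightarrow> word" where
  "S n = sing_word (int n - 2)"

lemma S_0: "S 0 = []" and S_1: "S (Suc 0) = [La]"
  by (simp_all add: S_def sing_word_def)

lemma S_Suc_Suc: "S (Suc (Suc n)) = other (last (Fw n)) # butlast (Fw n)"
  by (simp add: S_def sing_word_def)

lemma singular_iff: "singular w \<longleftrightarrow> (\<exists>n\<ge>1. w = S n)"
proof
  assume "singular w"
  then obtain k where "k \<ge> -1" "w = sing_word k" by (auto simp: singular_def)
  then show "\<exists>n\<ge>1. w = S n" by (intro exI[of _ "nat (k + 2)"]) (auto simp: S_def)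
next
  assume "\<exists>n\<ge>1. w = S n"
  then obtain n where "n \<ge> 1" "w = S n" by blast
  then show "singular w" unfolding singular_def S_def by (intro exI[of _ "int n - 2"]) auto
qed

lemma length_S: "length (S n) = fib n"
proof (cases n rule: fib.cases)
  case (3 m)
  then show ?thesis by (simp add: S_Suc_Suc length_Fw_nat del: fib.simps) (simp add: fib_neq_0_nat)
qed (simp_all add: S_0 S_1)

lemma last_Fw: "last (Fw k) = (if even k then La else Lb)"
proof (induction k)
  case 0
  show ?case by (simp add: Fw_0)
next
  case (Suc k)
  have "sigma (Fw k) = sigma (butlast (Fw k)) @ sigma_letter (last (Fw k))"
    by (metis Fw_nonempty append_butlast_last_id append_Nil2 sigma_simps)
  with Suc show ?case by (auto simp: Fw_Suc)
qed

text \<open>Applying \<open>\<sigma>\<close> to \<open>S n\<close> yields \<open>S (n + 1)\<close> up to a letter \<open>a\<close>, which is missing at the right end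
  if \<open>n\<close> is even and superfluous at the left end if \<open>n\<close> is odd. Writing this letter as a word that
  depends on the parity lets all later statements treat both cases at once.\<close>

definition pad :: "nat \<Rightarrow> word" where
  "pad n = (if even n then [] else [La])"

lemma pad_Suc_Suc [simp]: "pad (Suc (Suc n)) = pad n"
  by (simp add: pad_def)

lemma sigma_S: "sigma (S n) @ pad (Suc n) = pad n @ S (Suc n)"
proof (cases n rule: fib.cases)
  case (3 m)
  have F: "sigma (Fw m) = sigma (butlast (Fw m)) @ sigma_letter (last (Fw m))"
    by (metis Fw_nonempty append_butlast_last_id append_Nil2 sigma_simps)
  show ?thesis
    using 3 F by (simp add: S_Suc_Suc Fw_Suc last_Fw pad_def butlast_append)
qed (simp_all add: S_0 S_1 S_Suc_Suc pad_def Fw_0)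

text \<open>By induction along \<open>\<sigma>\<close>: the pads produced inside the image of \<open>S (n + 1) S n S (n + 1)\<close> fit
  together, because consecutive indices have opposite parity.\<close>

lemma S_rec: "S (n + 3) = S (n + 1) @ S n @ S (n + 1)"
proof (induction n)
  case 0
  show ?case by (simp add: numeral_3_eq_3 S_0 S_1 S_Suc_Suc Fw_Suc Fw_0)
next
  case (Suc n)
  have s0: "sigma (S n) @ pad (Suc n) = pad n @ S (Suc n)"
    and s1: "sigma (S (Suc n)) @ pad n = pad (Suc n) @ S (Suc (Suc n))"
    and s3: "sigma (S (n + 3)) @ pad n = pad (Suc n) @ S (n + 4)"
    using sigma_S[of n] sigma_S[of "Suc n"] sigma_S[of "n + 3"]
    by (simp_all add: numeral_eq_Suc)
  have "pad (Suc n) @ S (n + 4) = sigma (S (Suc n)) @ sigma (S n) @ sigma (S (Suc n)) @ pad n"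
    using s3[symmetric] Suc by simp
  also have "\<dots> = sigma (S (Suc n)) @ (sigma (S n) @ pad (Suc n)) @ S (Suc (Suc n))"
    using s1 by simp
  also have "\<dots> = (sigma (S (Suc n)) @ pad n) @ S (Suc n) @ S (Suc (Suc n))"
    using s0 by simp
  also have "\<dots> = pad (Suc n) @ S (Suc (Suc n)) @ S (Suc n) @ S (Suc (Suc n))"
    using s1 by simp
  finally show ?case by (simp add: numeral_eq_Suc)
qed

lemma rev_S: "rev (S n) = S n"
proof (induction n rule: less_induct)
  case (less n)
  show ?case
  proof (cases "n \<ge> 3")
    case True
    then obtain m where "n = m + 3" by (metis add.commute le_Suc_ex)
    then show ?thesis using less[of m] less[of "m + 1"] by (simp only: S_rec rev_append) simp
  next
    case False
    then have "n = 0 \<or> n = Suc 0 \<or> n = Suc (Suc 0)" by arith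
    then show ?thesis by (auto simp: S_0 S_1 S_Suc_Suc Fw_0)
  qed
qed

text \<open>If \<open>F\<^sub>m\<close> ends in \<open>\<alpha>\<close> and \<open>\<beta>\<close> is the other letter, then \<open>s\<^sub>m\<close> begins with \<open>\<beta>\<close>, \<open>s\<^sub>m\<^sub>-\<^sub>1\<close> begins with
  \<open>\<alpha>\<close>, and \<open>s\<^sub>m s\<^sub>m\<^sub>-\<^sub>1\<close> is \<open>\<beta>\<close> followed by \<open>F\<^sub>m\<^sub>+\<^sub>1 = F\<^sub>m F\<^sub>m\<^sub>-\<^sub>1\<close> without its last letter. Since \<open>F\<^sub>m\<^sub>+\<^sub>1\<close> ends
  in \<open>\<beta>\<close>, this differs from \<open>s\<^sub>m\<^sub>+\<^sub>1\<close> in the first letter only.\<close>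

lemma S_flip_first: "other (hd (S (n + 2))) # tl (S (n + 2)) = S (n + 1) @ S n"
proof (cases n rule: fib.cases)
  case (3 m)
  have "S (n + 2) = other (last (Fw m)) # Fw (Suc m) @ butlast (Fw m)"
    using 3 by (simp add: S_Suc_Suc Fw_Suc_Suc butlast_append)
  moreover have "Fw (Suc m) = butlast (Fw (Suc m)) @ [last (Fw (Suc m))]" by simp
  moreover have "S (n + 1) = other (last (Fw (Suc m))) # butlast (Fw (Suc m))"
    "S n = other (last (Fw m)) # butlast (Fw m)"
    using 3 by (simp_all add: S_Suc_Suc)
  ultimately show ?thesis by (auto simp: last_Fw)
qed (simp_all add: S_0 S_1 S_Suc_Suc Fw_Suc Fw_0)

lemma S_nonempty: "S (Suc n) \<noteq> []"
  using length_S[of "Suc n"] fib_neq_0_nat[of "Suc n"] by (metis list.size(3) neq0_conv zero_less_Suc)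

text \<open>The mirror image of \<open>S_flip_first\<close>, as singular words are palindromes.\<close>

lemma S_flip_last: "butlast (S (n + 2)) @ [other (last (S (n + 2)))] = S n @ S (n + 1)"
proof -
  have "rev (other (hd (S (n + 2))) # tl (S (n + 2))) = S n @ S (n + 1)"
    unfolding S_flip_first by (simp add: rev_S)
  moreover have "hd (S (n + 2)) = last (S (n + 2))"
    using rev_S[of "n + 2"] S_nonempty[of "n + 1"] by (metis hd_rev)
  moreover have "rev (tl (S (n + 2))) = butlast (S (n + 2))"
    using rev_S[of "n + 2"] by (metis butlast_rev)
  ultimately show ?thesis by simp
qed

lemma hd_S: "hd (S (Suc n)) = (if even n then La else Lb)"
  by (cases n) (auto simp: S_1 S_Suc_Suc last_Fw)

lemma last_S: "last (S (Suc n)) = (if even n then La else Lb)"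
  using hd_S[of n] rev_S[of "Suc n"] S_nonempty[of n] by (metis hd_rev)

section \<open>The neighbourhood of a singular word\<close>

lemma sigma_tl_S: "tl (S (Suc (Suc n))) = sigma (tl (S (Suc n))) @ pad n"
proof -
  have s: "S (Suc n) = hd (S (Suc n)) # tl (S (Suc n))"
    using S_nonempty[of n] by simp
  have "pad (Suc n) @ S (Suc (Suc n)) = sigma (S (Suc n)) @ pad n"
    using sigma_S[of "Suc n"] by (simp add: pad_def)
  also have "\<dots> = sigma_letter (hd (S (Suc n))) @ sigma (tl (S (Suc n))) @ pad n"
    by (subst s) simp
  finally show ?thesis by (auto simp: hd_S pad_def split: if_splits)
qed

lemma sigma_butlast_S: "pad (Suc n) @ butlast (S (Suc (Suc n))) = sigma (butlast (S (Suc n))) @ [La]"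
proof -
  have s: "S (Suc n) = butlast (S (Suc n)) @ [last (S (Suc n))]"
    using S_nonempty[of n] by simp
  have "pad (Suc n) @ S (Suc (Suc n)) = sigma (S (Suc n)) @ pad n"
    using sigma_S[of "Suc n"] by (simp add: pad_def)
  also have "\<dots> = sigma (butlast (S (Suc n))) @ sigma_letter (last (S (Suc n))) @ pad n"
    by (subst s) simp
  finally have "butlast (pad (Suc n) @ S (Suc (Suc n))) =
      butlast (sigma (butlast (S (Suc n))) @ sigma_letter (last (S (Suc n))) @ pad n)" by simp
  then show ?thesis using S_nonempty[of "Suc n"]
    by (auto simp: last_S pad_def butlast_append split: if_splits)
qed

text \<open>For odd \<open>n\<close> the word \<open>S (n + 1)\<close> begins and ends with \<open>b\<close>, so in \<open>\<sigma>(z)a\<close> it is enclosed by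
  letters \<open>a\<close>. In both parities an occurrence of \<open>S (n + 1)\<close> is therefore one of \<open>\<sigma>(S n)a\<close>, up to
  the pads, and this can be desubstituted.\<close>

lemma desubstitute_S:
  assumes eq: "sigma z @ [La] = X @ S (Suc n) @ Y"
  shows "\<exists>z1 z2. z = z1 @ S n @ z2 \<and> X = sigma z1 @ pad n \<and> sigma z2 @ [La] = pad (Suc n) @ Y"
proof -
  obtain X' Y' where X: "X = X' @ pad n" and Y: "La # Y' = pad (Suc n) @ Y"
  proof (cases "even n")
    case True
    with that show ?thesis by (simp add: pad_def)
  next
    case False
    have "sigma z @ [La] = X @ Lb # tl (S (Suc n)) @ Y"
      using eq hd_S[of n] S_nonempty[of n] False by (cases "S (Suc n)") auto
    from Lb_isolated[OF this] obtain X' where "X = X' @ [La]" by blast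
    moreover have "sigma z @ [La] = (X @ butlast (S (Suc n))) @ Lb # Y"
      using eq last_S[of n] S_nonempty[of n] False
      by (metis append_assoc append_Cons append_Nil append_butlast_last_id)
    from Lb_isolated[OF this] obtain Y' where "Y = La # Y'" by blast
    ultimately show ?thesis using that False by (simp add: pad_def)
  qed
  have "sigma z @ [La] = X' @ (pad n @ S (Suc n)) @ Y" using eq X by simp
  also have "\<dots> = X' @ sigma (S n) @ La # Y'"
    unfolding sigma_S[symmetric] Y by simp
  finally obtain z1 z2 where "z = z1 @ S n @ z2" "X' = sigma z1" "sigma z2 @ [La] = La # Y'"
    using desubstitute by blast
  then show ?thesis using X Y by metis
qed

text \<open>The words \<open>x\<close> and \<open>y\<close> absorb the case that the given factor ends within the forced surroundings.
  The induction step desubstitutes to an occurrence of the preceding singular word, and maps its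
  surroundings forward again by \<open>sigma_tl_S\<close> and \<open>sigma_butlast_S\<close>.\<close>

lemma S_context:
  assumes "Fib_factor (u @ S (Suc n) @ v)"
  shows "\<exists>x y. suffix (tl (S (n + 2))) (x @ u) \<and> prefix (butlast (S (n + 2))) (v @ y)"
  using assms
proof (induction n arbitrary: u v)
  case 0
  show ?case by (simp add: S_Suc_Suc Fw_0 numeral_2_eq_2)
next
  case (Suc n)
  let ?l = "tl (S (n + 2))" and ?r = "butlast (S (n + 2))"
  obtain z p q where z: "Fib_factor z"
    and eq: "p @ (u @ S (Suc (Suc n)) @ v) @ q = sigma z @ [La]"
    using Fib_factor_in_sigma[OF Suc.prems] .
  then have "sigma z @ [La] = (p @ u) @ S (Suc (Suc n)) @ (v @ q)" by simp
  from desubstitute_S[OF this] obtain z1 z2 where zz: "z = z1 @ S (Suc n) @ z2" and X: "p @ u = sigma z1 @ pad (Suc n)"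
    and Y: "sigma z2 @ [La] = pad (Suc (Suc n)) @ v @ q"
    by auto
  obtain x y where x: "suffix ?l (x @ z1)" and y: "prefix ?r (z2 @ y)"
    using Suc.IH z zz by blast
  from x obtain l' where l': "x @ z1 = l' @ ?l" by (auto simp: suffix_def)
  from y obtain r' where r': "z2 @ y = ?r @ r'" by (auto simp: prefix_def)
  have "sigma x @ p @ u = sigma (x @ z1) @ pad (Suc n)" by (simp add: X)
  also have "\<dots> = sigma l' @ tl (S (n + 3))"
    unfolding l' using sigma_tl_S[of "Suc n"] by (simp add: numeral_eq_Suc)
  finally have left: "suffix (tl (S (n + 3))) ((sigma x @ p) @ u)"
    by (simp add: suffix_def)
  \<comment> \<open>Both \<open>\<sigma>(z2)\<close> and \<open>\<sigma>(?r)\<close> are followed by a letter \<open>a\<close> in \<open>\<sigma>(z2 y)a = \<sigma>(?r r')a\<close>, whatever \<open>y\<close> and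
    \<open>r'\<close> are.\<close>
  obtain t where t: "sigma r' @ [La] = La # t" using sigma_La_begins by blast
  obtain s where s: "sigma y @ [La] = La # s" using sigma_La_begins by blast
  have "pad (Suc (Suc n)) @ v @ q @ s = sigma (z2 @ y) @ [La]"
    using Y s by (metis append.assoc append_Cons append_Nil sigma_simps(3))
  also have "\<dots> = sigma ?r @ [La] @ t" unfolding r' using t by simp
  also have "\<dots> = pad (Suc (Suc n)) @ butlast (S (n + 3)) @ t"
    using sigma_butlast_S[of "Suc n"] by (simp add: numeral_eq_Suc)
  finally have right: "prefix (butlast (S (n + 3))) (v @ q @ s)" by (simp add: prefix_def)
  have "Suc n + 2 = n + 3" by simp
  then show ?case using left right by (simp only:) blast
qed

text \<open>The word in question is the palindrome obtained from \<open>a\<close> by iterating \<open>z \<mapsto> \<sigma>(z)a\<close>, so a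
  second occurrence would desubstitute down to a second occurrence of \<open>a\<close> in \<open>a\<close>.\<close>

lemma S_occurs_once_in_context:
  assumes "tl (S (n + 2)) @ S (Suc n) @ butlast (S (n + 2)) = u @ S (Suc n) @ v"
  shows "u = tl (S (n + 2))"
  using assms
proof (induction n arbitrary: u v)
  case 0
  then show ?case by (simp add: S_1 S_Suc_Suc Fw_0 numeral_2_eq_2 append_eq_Cons_conv Cons_eq_append_conv)
next
  case (Suc n)
  let ?E = "tl (S (n + 2)) @ S (Suc n) @ butlast (S (n + 2))"
  have "sigma ?E @ [La] = sigma (tl (S (n + 2))) @ sigma (S (Suc n)) @ pad (Suc (Suc n)) @ butlast (S (n + 3))"
    using sigma_butlast_S[of "Suc n"] by (simp add: numeral_eq_Suc)
  also have "\<dots> = sigma (tl (S (n + 2))) @ pad (Suc n) @ S (Suc (Suc n)) @ butlast (S (n + 3))"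
    using sigma_S[of "Suc n"] by (metis append.assoc)
  also have "\<dots> = tl (S (n + 3)) @ S (Suc (Suc n)) @ butlast (S (n + 3))"
    using sigma_tl_S[of "Suc n"] by (simp add: numeral_eq_Suc)
  also have "\<dots> = u @ S (Suc (Suc n)) @ v" using Suc.prems by (simp add: numeral_eq_Suc)
  finally obtain z1 z2 where "?E = z1 @ S (Suc n) @ z2" and u: "u = sigma z1 @ pad (Suc n)"
    using desubstitute_S[of ?E u "Suc n" v] by force
  then have "z1 = tl (S (n + 2))" using Suc.IH by blast
  then have "u = sigma (tl (S (Suc (Suc n)))) @ pad (Suc n)" using u by simp
  also have "\<dots> = tl (S (Suc (Suc (Suc n))))" using sigma_tl_S[of "Suc n"] by simp
  finally show ?case by simp
qed

section \<open>The singular decomposition\<close>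

lemma letter_neq: "(c::letter) \<noteq> d \<Longrightarrow> c = other d"
  by (cases c; cases d) auto

text \<open>An affix that outgrows its forced context exhibits \<open>S (n + 2)\<close> or, after the other letter,
  \<open>S (n + 1) S n S (n + 1) = S (n + 3)\<close>.\<close>

lemma affixes_of_maximal_S:
  assumes fac: "Fib_factor (u @ S (Suc n) @ v)"
    and max: "\<And>j. j > Suc n \<Longrightarrow> \<not> sublist (S j) (u @ S (Suc n) @ v)"
  shows "suffix u (tl (S (n + 2)))" and "prefix v (butlast (S (n + 2)))"
proof -
  let ?w = "u @ S (Suc n) @ v"
  obtain x y where x: "suffix (tl (S (n + 2))) (x @ u)" and y: "prefix (butlast (S (n + 2))) (v @ y)"
    using S_context[OF fac] by blast
  have ne: "S (n + 2) \<noteq> []" using S_nonempty[of "n + 1"] by simp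
  have S2: "\<not> sublist (S (n + 2)) ?w" and S3: "\<not> sublist (S (n + 3)) ?w"
    using max[of "n + 2"] max[of "n + 3"] by auto
  show "suffix u (tl (S (n + 2)))"
  proof (rule ccontr)
    assume n: "\<not> suffix u (tl (S (n + 2)))"
    then have "suffix (tl (S (n + 2))) u"
      using suffix_same_cases[OF x suffixI[OF refl]] by blast
    then obtain u' where u': "u = u' @ tl (S (n + 2))" by (auto simp: suffix_def)
    with n have "u' \<noteq> []" by auto
    then obtain u'' c where u'': "u = u'' @ c # tl (S (n + 2))"
      using u' by (cases u' rule: rev_cases) auto
    show False
    proof (cases "c = hd (S (n + 2))")
      case True
      then have "u = u'' @ S (n + 2)" using u'' ne by simp
      then show False using S2 by (auto simp: sublist_def)
    next
      case False
      then have "u = u'' @ S (n + 1) @ S n"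
        using u'' letter_neq S_flip_first[of n] by auto
      then have "?w = u'' @ S (n + 3) @ v" by (simp add: S_rec)
      then show False using S3 unfolding sublist_def by metis
    qed
  qed
  show "prefix v (butlast (S (n + 2)))"
  proof (rule ccontr)
    assume n: "\<not> prefix v (butlast (S (n + 2)))"
    then have "prefix (butlast (S (n + 2))) v"
      using prefix_same_cases[OF y prefixI[OF refl]] by blast
    then obtain v' where v': "v = butlast (S (n + 2)) @ v'" by (auto simp: prefix_def)
    with n have "v' \<noteq> []" by auto
    then obtain v'' c where v'': "v = (butlast (S (n + 2)) @ [c]) @ v''"
      using v' by (cases v') auto
    show False
    proof (cases "c = last (S (n + 2))")
      case True
      then have "v = S (n + 2) @ v''" using v'' ne by simp
      then have "?w = (u @ S (Suc n)) @ S (n + 2) @ v''" by simp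
      then show False using S2 unfolding sublist_def by metis
    next
      case False
      then have "v = (S n @ S (n + 1)) @ v''"
        using v'' letter_neq S_flip_last[of n] by metis
      then have "?w = u @ S (n + 3) @ v''" by (simp add: S_rec)
      then show False using S3 unfolding sublist_def by metis
    qed
  qed
qed

text \<open>The affixes of one occurrence embed the whole word into the forced context, in which
  \<open>S (n + 1)\<close> occurs once.\<close>

lemma maximal_S_occurs_once:
  assumes fac: "Fib_factor w" and w: "w = u @ S (Suc n) @ v" "w = u' @ S (Suc n) @ v'"
    and max: "\<And>j. j > Suc n \<Longrightarrow> \<not> sublist (S j) w"
  shows "u' = u \<and> v' = v"
proof -
  have "suffix u (tl (S (n + 2)))" "prefix v (butlast (S (n + 2)))"
    using affixes_of_maximal_S[of u n v] fac max w(1) by auto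
  then obtain x y where x: "tl (S (n + 2)) = x @ u" and y: "butlast (S (n + 2)) = v @ y"
    by (auto simp: suffix_def prefix_def)
  have "tl (S (n + 2)) @ S (Suc n) @ butlast (S (n + 2)) = (x @ u') @ S (Suc n) @ (v' @ y)"
    unfolding x y using w by simp
  then have "x @ u' = x @ u" using S_occurs_once_in_context x by metis
  with w show ?thesis by simp
qed

lemma Lb_Lb_not_Fib_factor: "\<not> Fib_factor (p @ Lb # Lb # q)"
proof
  assume "Fib_factor (p @ Lb # Lb # q)"
  then obtain z x y where "x @ (p @ Lb # Lb # q) @ y = sigma z @ [La]"
    by (rule Fib_factor_in_sigma)
  then have "sigma z @ [La] = (x @ p) @ Lb # (Lb # q @ y)" by simp
  from Lb_isolated[OF this] show False by simp
qed

lemma S_3: "S 3 = [La, La]" and S_4: "S 4 = [Lb, La, Lb]" and S_2: "S 2 = [Lb]"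
  by (simp_all add: numeral_eq_Suc S_Suc_Suc Fw_Suc Fw_0)

text \<open>A factor that avoids \<open>aa\<close>, and \<open>bb\<close> anyway, alternates between the letters, and from length four on it
  contains \<open>bab\<close>.\<close>

lemma exceptional_if_small:
  assumes fac: "Fib_factor w" and a: "La \<in> set w" and b: "Lb \<in> set w"
    and "\<not> sublist (S 3) w" and "\<not> sublist (S 4) w"
  shows "w \<in> exceptional"
proof -
  have no: "w \<noteq> p @ La # La # q" "w \<noteq> p @ Lb # La # Lb # q" "w \<noteq> p @ Lb # Lb # q" for p q
    using assms Lb_Lb_not_Fib_factor by (auto simp: S_3 S_4 sublist_def)
  consider "w = []" | c where "w = [c]" | c d where "w = [c, d]" | c d e where "w = [c, d, e]"
    | c d e f x where "w = c # d # e # f # x"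
    by (metis list.exhaust)
  then show ?thesis
  proof cases
    case 1
    then show ?thesis by (simp add: exceptional_def)
  next
    case (2 c)
    then show ?thesis using a b by auto
  next
    case (3 c d)
    then show ?thesis using a b
      by (cases c; cases d) (simp_all add: exceptional_def)
  next
    case (4 c d e)
    then show ?thesis
      using no(1)[of "[]" "[e]"] no(3)[of "[]" "[e]"] no(1)[of "[c]" "[]"] no(3)[of "[c]" "[]"]
        no(2)[of "[]" "[]"]
      by (cases c; cases d; cases e) (simp_all add: exceptional_def)
  next
    case (5 c d e f x)
    then show ?thesis
      using no(1)[of "[]" "e # f # x"] no(3)[of "[]" "e # f # x"]
        no(1)[of "[c]" "f # x"] no(3)[of "[c]" "f # x"] no(1)[of "[c, d]" x] no(3)[of "[c, d]" x]
        no(2)[of "[]" "f # x"] no(2)[of "[c]" x]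
      by (cases c; cases d; cases e; cases f) simp_all
  qed
qed

lemma fib_inj:
  assumes "1 \<le> i" "i < j" "fib i = fib j"
  shows "i = 1 \<and> j = 2"
proof -
  have less: "fib m < fib (Suc m)" if "m \<ge> 2" for m
    using that by (cases m rule: fib.cases) (auto simp: fib_neq_0_nat)
  have "i < 2"
  proof (rule ccontr)
    assume "\<not> i < 2"
    then have "fib i < fib (Suc i)" using less by simp
    also have "\<dots> \<le> fib j" using assms by (intro fib_mono) simp
    finally show False using assms by simp
  qed
  moreover have "\<not> j > 2"
  proof
    assume "j > 2"
    then have "fib 3 \<le> fib j" by (intro fib_mono) simp
    moreover have "i = 1" using \<open>i < 2\<close> \<open>1 \<le> i\<close> by linarith
    ultimately show False using assms by (simp add: numeral_3_eq_3)
  qed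
  ultimately show ?thesis using assms by linarith
qed

lemma S_inj: "1 \<le> i \<Longrightarrow> 1 \<le> j \<Longrightarrow> S i = S j \<Longrightarrow> i = j"
proof (rule ccontr)
  assume *: "1 \<le> i" "1 \<le> j" "S i = S j" "i \<noteq> j"
  then have "fib i = fib j" using length_S by metis
  with * have "i = 1 \<and> j = 2 \<or> j = 1 \<and> i = 2"
    using fib_inj[of i j] fib_inj[of j i] by (metis nat_neq_iff)
  with *(3) show False using S_1 S_2 by auto
qed

text \<open>The length of a singular word determines it, except that \<open>S 1 = a\<close> and \<open>S 2 = b\<close> both have length one.
  These two tie for the longest singular factor only in exceptional words; without a tie \<open>sk w\<close> is the \<open>S N\<close> of largest index \<open>N\<close> that occurs in \<open>w\<close>.\<close>

lemma sk_eq_S: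
  assumes fac: "Fib_factor w" and ne: "w \<notin> exceptional" and n: "n \<ge> 1" and sk: "sk w = S n"
  shows "sublist (S n) w \<and> (\<forall>j>n. \<not> sublist (S j) w)"
proof -
  define A where "A = {j. 1 \<le> j \<and> sublist (S j) w}"
  have "A \<subseteq> {..length w + 1}"
  proof
    fix j assume "j \<in> A"
    then have "fib j \<le> length w" unfolding A_def
      using sublist_length_le length_S by (metis mem_Collect_eq)
    with le_Suc_fib[of j] show "j \<in> {..length w + 1}" by simp
  qed
  then have fin: "finite A" by (rule finite_subset) simp
  obtain c w' where "w = c # w'" using ne by (cases w) (auto simp: exceptional_def)
  then have "sublist [c] w" by (auto simp: sublist_def)
  then have "A \<noteq> {}" unfolding A_def using S_1 S_2
    by (cases c) (auto intro: exI[of _ 1] exI[of _ 2])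
  define N where "N = Max A"
  have NA: "N \<in> A" and Nmax: "\<And>j. j \<in> A \<Longrightarrow> j \<le> N"
    unfolding N_def using fin \<open>A \<noteq> {}\<close> by auto
  have "sk w = S N" unfolding sk_def
  proof (rule the_equality)
    show "singular (S N) \<and> sublist (S N) w \<and> (\<forall>t. singular t \<and> sublist t w \<longrightarrow> length t \<le> length (S N))"
      using NA Nmax by (auto simp: singular_iff A_def length_S intro!: fib_mono)
  next
    fix s assume s: "singular s \<and> sublist s w \<and> (\<forall>t. singular t \<and> sublist t w \<longrightarrow> length t \<le> length s)"
    then obtain j where j: "j \<in> A" "s = S j" by (auto simp: singular_iff A_def)
    have "fib N \<le> fib j" using s j NA by (auto simp: singular_iff A_def length_S[symmetric])
    moreover have "fib j \<le> fib N" using Nmax[OF j(1)] by (rule fib_mono)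
    ultimately have eq: "fib j = fib N" by simp
    have "j = N"
    proof (rule ccontr)
      assume "j \<noteq> N"
      with Nmax[OF j(1)] have "j < N" by simp
      with eq j(1) have jN: "j = 1 \<and> N = 2" using fib_inj[of j N] by (auto simp: A_def)
      have "La \<in> set w" "Lb \<in> set w"
        using set_mono_sublist[of "S 1" w] set_mono_sublist[of "S 2" w] j(1) NA jN
        by (auto simp: A_def S_1 S_2)
      moreover have "\<not> sublist (S 3) w" "\<not> sublist (S 4) w"
        using Nmax[of 3] Nmax[of 4] jN by (auto simp: A_def)
      ultimately show False using exceptional_if_small fac ne by blast
    qed
    with j show "s = S N" by simp
  qed
  with sk n NA have "n = N" using S_inj[of n N] by (auto simp: A_def)
  moreover have "\<not> sublist (S j) w" if "j > N" for j
    using Nmax[of j] that n \<open>n = N\<close> by (auto simp: A_def)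
  ultimately show ?thesis using NA by (simp add: A_def)
qed

lemma sing_decomp_affixes:
  assumes fac: "Fib_factor w" and ne: "w \<notin> exceptional" and sk: "sk w = S (Suc n)"
  shows "w = mu1 w @ S (Suc n) @ mu2 w"
    and "strict_suffix (mu1 w) (S (n + 2))" and "strict_prefix (mu2 w) (S (n + 2))"
proof -
  have sub: "sublist (S (Suc n)) w" and max: "\<And>j. j > Suc n \<Longrightarrow> \<not> sublist (S j) w"
    using sk_eq_S[OF fac ne _ sk] by auto
  from sub obtain u v where w: "w = u @ S (Suc n) @ v" by (auto simp: sublist_def)
  have "sing_decomp w = (u, v)" unfolding sing_decomp_def sk
  proof (rule the_equality)
    show "case (u, v) of (u, v) \<Rightarrow> w = u @ S (Suc n) @ v" using w by simp
  next
    fix p assume "case p of (u, v) \<Rightarrow> w = u @ S (Suc n) @ v"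
    then show "p = (u, v)"
      using maximal_S_occurs_once[OF fac w _ max] by (cases p) auto
  qed
  then have mu: "mu1 w = u" "mu2 w = v" by (simp_all add: mu1_def mu2_def)
  show "w = mu1 w @ S (Suc n) @ mu2 w" using w mu by simp
  have aff: "suffix u (tl (S (n + 2)))" "prefix v (butlast (S (n + 2)))"
    using affixes_of_maximal_S[of u n v] fac max w by auto
  have S: "S (n + 2) = hd (S (n + 2)) # tl (S (n + 2))"
    "S (n + 2) = butlast (S (n + 2)) @ [last (S (n + 2))]"
    using S_nonempty[of "n + 1"] by simp_all
  show "strict_suffix (mu1 w) (S (n + 2))"
    using aff(1) S(1) mu by (metis strict_suffix_def suffix_Cons suffix_length_le length_Cons
        Suc_n_not_le_n)
  show "strict_prefix (mu2 w) (S (n + 2))"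
    using aff(2) S(2) mu by (metis strict_prefix_def prefix_snoc prefix_length_le length_append_singleton
        Suc_n_not_le_n)
qed

lemma suffix_eq_subword:
  assumes "suffix u s"
  shows "u = subword s (int (length s) - int (length u) + 1) (int (length s))"
proof -
  obtain x where "s = x @ u" using assms by (auto simp: suffix_def)
  then show ?thesis by (simp add: subword_def)
qed

lemma prefix_eq_subword: "prefix v s \<Longrightarrow> v = subword s 1 (int (length v))"
  by (auto simp: prefix_def subword_def)

lemma fibnum_index_unique:
  assumes "0 \<le> k" "fibnum k \<le> n" "n < fibnum (k + 1)"
    and "0 \<le> l" "fibnum l \<le> n" "n < fibnum (l + 1)"
  shows "l = k"
proof -
  have mono: "fibnum i \<le> fibnum j" if "i \<le> j" for i j
    unfolding fibnum_def using that by (simp add: fib_mono nat_mono)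
  show ?thesis using mono[of "k + 1" l] mono[of "l + 1" k] assms by linarith
qed

lemma T1_sk:
  assumes "w \<in> T1 j" "0 \<le> k" "fibnum k \<le> int (length w)" "int (length w) < fibnum (k + 1)"
  shows "int (length w) = fibnum k" "sk w = sing_word (k - j + 1)" "j = 3 \<Longrightarrow> k \<ge> 1"
  using assms fibnum_index_unique[of k "int (length w)"] unfolding T1_def by blast+

lemma T2_sk:
  assumes "w \<in> T2 j" "0 \<le> k" "fibnum k \<le> int (length w)" "int (length w) < fibnum (k + 1)"
  shows "sk w = sing_word (k - j + 1)" "j = 3 \<Longrightarrow> k \<ge> 1"
  using assms fibnum_index_unique[of k "int (length w)"] unfolding T2_def by blast+

lemma S_affixes: "prefix (S n) (S (n + 2))" "suffix (S n) (S (n + 2))"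
proof -
  have "prefix (S n) (S (n + 2)) \<and> suffix (S n) (S (n + 2))"
  proof (cases n)
    case 0
    then show ?thesis by (simp add: S_0)
  next
    case (Suc m)
    have "S (Suc m + 2) = S (m + 3)" by (simp add: numeral_eq_Suc)
    also have "\<dots> = S (Suc m) @ S m @ S (Suc m)" using S_rec[of m] by simp
    finally show ?thesis using suffixI[of _ "S (Suc m) @ S m" "S (Suc m)"] Suc by simp
  qed
  then show "prefix (S n) (S (n + 2))" "suffix (S n) (S (n + 2))" by auto
qed

theorem theorem2p3:
  fixes w :: word and n k :: int
  assumes "Fib_factor w"
    and "w \<notin> exceptional"
    and "n = int (length w)"
    and "k \<ge> 0"
    and "fibnum k \<le> n" and "n < fibnum (k + 1)"
  shows
    "(w \<in> T1 1 \<longrightarrow> mu1 w = [] \<and> mu2 w = []) \<and>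
     (w \<in> T1 2 \<longrightarrow> (\<exists>i. fibnum (k - 1) - 1 \<le> i \<and> i \<le> fibnum k - 1 \<and>
        mu1 w = subword (sing_word (k - 2)) (i - fibnum (k - 1) + 2) (fibnum (k - 2)) \<and>
        mu2 w = subword (sing_word (k - 2)) 1 (i - fibnum (k - 1) + 1))) \<and>
     (w \<in> T1 3 \<longrightarrow> (\<exists>i. 0 \<le> i \<and> i \<le> fibnum (k - 1) - 2 \<and>
        mu1 w = subword (sing_word (k - 1)) (i + 2) (fibnum (k - 1)) \<and>
        mu2 w = subword (sing_word (k - 1)) 1 (i + 1))) \<and>
     (w \<in> T2 1 \<longrightarrow> (\<exists>i. 0 \<le> i \<and> i \<le> n - fibnum k \<and>
        mu1 w = subword (sing_word (k - 1)) (fibnum (k - 1) - i + 1) (fibnum (k - 1)) \<and>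
        mu2 w = subword (sing_word (k - 1)) 1 (n - fibnum k - i))) \<and>
     (w \<in> T2 2 \<longrightarrow> (\<exists>i. 0 \<le> i \<and> i \<le> n - fibnum (k - 1) \<and>
        mu1 w = subword (sing_word k) (fibnum k - i + 1) (fibnum k) \<and>
        mu2 w = subword (sing_word k) 1 (n - fibnum (k - 1) - i))) \<and>
     (w \<in> T2 3 \<longrightarrow> (\<exists>i. 0 \<le> i \<and> i \<le> fibnum (k + 1) - n - 2 \<and>
        mu1 w = subword (sing_word (k - 1)) (fibnum (k + 1) - n - i) (fibnum (k - 1)) \<and>
        mu2 w = subword (sing_word (k - 1)) 1 (fibnum (k - 1) - i - 1)))"
proof -
  define K where "K = nat k"
  have k: "k = int K" using assms by (simp add: K_def)
  have sing: "sing_word k = S (K + 2)" "sing_word (k - 1) = S (K + 1)" "sing_word (k - 2) = S K"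
    by (simp_all add: S_def k)
  have len: "int (length (S (K + 2))) = fibnum k" "int (length (S (K + 1))) = fibnum (k - 1)"
    "int (length (S K)) = fibnum (k - 2)"
    by (simp_all add: length_S fibnum_def k nat_add_distrib)
  have rec: "fibnum (k + 1) = fibnum k + fibnum (k - 1)" "fibnum k = fibnum (k - 1) + fibnum (k - 2)"
    using fibnum_rec[of k] fibnum_rec[of "k - 1"] assms(4) by simp_all
  note T1 = T1_sk[OF _ assms(4) assms(5)[unfolded assms(3)] assms(6)[unfolded assms(3)]]
  note T2 = T2_sk[OF _ assms(4) assms(5)[unfolded assms(3)] assms(6)[unfolded assms(3)]]
  define u v where "u = mu1 w" and "v = mu2 w"
  have sufI: "u = subword (S m) i l"
    if "suffix u (S m)" "l = int (length (S m))" "i = l - int (length u) + 1" for m i l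
    using suffix_eq_subword[OF that(1)] that(2,3) by simp
  have preI: "v = subword (S m) 1 i" if "prefix v (S m)" "i = int (length v)" for m i
    using prefix_eq_subword[OF that(1)] that(2) by simp

  have decomp: "n = int (length u) + int (length (S (Suc m))) + int (length v)"
    "suffix u (S (m + 2))" "length u < length (S (m + 2))"
    "prefix v (S (m + 2))" "length v < length (S (m + 2))" if "sk w = S (Suc m)" for m
  proof -
    note d = sing_decomp_affixes[OF assms(1,2) that, folded u_def v_def]
    show "n = int (length u) + int (length (S (Suc m))) + int (length v)"
      using arg_cong[OF d(1), of length] assms(3) by simp
    show "suffix u (S (m + 2))" "prefix v (S (m + 2))"
      using d(2,3) by (simp_all add: strict_suffix_def strict_prefix_def)
    show "length u < length (S (m + 2))" using d(2)
      by (auto simp: strict_suffix_def suffix_def)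
    show "length v < length (S (m + 2))" using d(3)
      by (auto simp: strict_prefix_def prefix_def)
  qed

  have c1: "u = [] \<and> v = []" if "w \<in> T1 1"
  proof -
    have "sk w = S (Suc (K + 1))" using T1(2)[OF that] sing by simp
    from decomp(1)[OF this] have "n = int (length u) + fibnum k + int (length v)"
      using len by simp
    then have "length u = 0 \<and> length v = 0" using T1(1)[OF that] assms(3) by linarith
    then show ?thesis by simp
  qed

  have c2: "\<exists>i. fibnum (k - 1) - 1 \<le> i \<and> i \<le> fibnum k - 1 \<and>
      u = subword (S K) (i - fibnum (k - 1) + 2) (fibnum (k - 2)) \<and>
      v = subword (S K) 1 (i - fibnum (k - 1) + 1)" if "w \<in> T1 2"
  proof -
    have "sk w = S (Suc K)" using T1(2)[OF that] sing by (simp add: algebra_simps)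
    note d = decomp[OF this]
    have sum: "int (length u) + int (length v) = fibnum (k - 2)"
      using d(1) T1(1)[OF that] len rec assms(3) by simp
    \<comment> \<open>The two remainders together are as long as \<open>S K\<close>, so as affixes of \<open>S (K + 2)\<close> they
      lie inside its prefix and its suffix \<open>S K\<close>.\<close>
    then have "length u \<le> length (S K)" "length v \<le> length (S K)" using len by linarith+
    then have aff: "suffix u (S K)" "prefix v (S K)"
      using d(2,4) S_affixes[of K] suffix_length_suffix prefix_length_prefix by blast+
    show ?thesis
    proof (intro exI conjI)
      show "fibnum (k - 1) - 1 \<le> fibnum (k - 1) - 1 + int (length v)"
        "fibnum (k - 1) - 1 + int (length v) \<le> fibnum k - 1"
        using sum len rec by linarith+
      show "u = subword (S K) (fibnum (k - 1) - 1 + int (length v) - fibnum (k - 1) + 2) (fibnum (k - 2))"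
        by (rule sufI) (use aff(1) sum len rec in \<open>(assumption | linarith)+\<close>)
      show "v = subword (S K) 1 (fibnum (k - 1) - 1 + int (length v) - fibnum (k - 1) + 1)"
        by (rule preI) (use aff(2) sum len rec in \<open>(assumption | linarith)+\<close>)
    qed
  qed

  have c3: "\<exists>i. 0 \<le> i \<and> i \<le> fibnum (k - 1) - 2 \<and>
      u = subword (S (K + 1)) (i + 2) (fibnum (k - 1)) \<and>
      v = subword (S (K + 1)) 1 (i + 1)" if t: "w \<in> T1 3"
  proof -
    obtain m where m: "K = Suc m" using T1(3)[OF t] k by (cases K) auto
    have "sk w = S (Suc m)" using T1(2)[OF t] sing m by (simp add: algebra_simps)
    note d = decomp[OF this]
    have sum: "int (length u) + int (length v) = fibnum (k - 1)"
      using d(1) T1(1)[OF t] len rec assms(3) m by simp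
    \<comment> \<open>Both bounds on the witness express that \<open>u\<close> and \<open>v\<close> are proper affixes.\<close>
    have aff: "suffix u (S (K + 1))" "prefix v (S (K + 1))"
      and short: "length u < length (S (K + 1))" "length v < length (S (K + 1))"
      using d(2-5) m by simp_all
    show ?thesis
    proof (intro exI conjI)
      show "0 \<le> int (length v) - 1" "int (length v) - 1 \<le> fibnum (k - 1) - 2"
        using sum len short by linarith+
      show "u = subword (S (K + 1)) (int (length v) - 1 + 2) (fibnum (k - 1))"
        by (rule sufI) (use aff(1) sum len short in \<open>(assumption | linarith)+\<close>)
      show "v = subword (S (K + 1)) 1 (int (length v) - 1 + 1)"
        by (rule preI) (use aff(2) sum len short in \<open>(assumption | linarith)+\<close>)
    qed
  qed

  have c4: "\<exists>i. 0 \<le> i \<and> i \<le> n - fibnum k \<and>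
      u = subword (S (K + 1)) (fibnum (k - 1) - i + 1) (fibnum (k - 1)) \<and>
      v = subword (S (K + 1)) 1 (n - fibnum k - i)" if "w \<in> T2 1"
  proof -
    have "sk w = S (Suc (K + 1))" using T2(1)[OF that] sing by simp
    note d = decomp[OF this]
    have sum: "int (length u) + int (length v) = n - fibnum k"
      using d(1) len by simp
    \<comment> \<open>Since \<open>n < fibnum (k + 1)\<close>, the remainders are too short to leave the prefix and the
      suffix \<open>S (K + 1)\<close> of \<open>S (K + 3)\<close>.\<close>
    then have "length u \<le> length (S (K + 1))" "length v \<le> length (S (K + 1))"
      using len rec assms(6) by linarith+
    then have aff: "suffix u (S (K + 1))" "prefix v (S (K + 1))"
      using d(2,4) S_affixes[of "K + 1"] suffix_length_suffix prefix_length_prefix by blast+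
    show ?thesis
    proof (intro exI conjI)
      show "0 \<le> int (length u)" "int (length u) \<le> n - fibnum k"
        using sum len by linarith+
      show "u = subword (S (K + 1)) (fibnum (k - 1) - int (length u) + 1) (fibnum (k - 1))"
        by (rule sufI) (use aff(1) sum len in \<open>(assumption | linarith)+\<close>)
      show "v = subword (S (K + 1)) 1 (n - fibnum k - int (length u))"
        by (rule preI) (use aff(2) sum len in \<open>(assumption | linarith)+\<close>)
    qed
  qed

  have c5: "\<exists>i. 0 \<le> i \<and> i \<le> n - fibnum (k - 1) \<and>
      u = subword (S (K + 2)) (fibnum k - i + 1) (fibnum k) \<and>
      v = subword (S (K + 2)) 1 (n - fibnum (k - 1) - i)" if "w \<in> T2 2"
  proof -
    have "sk w = S (Suc K)" using T2(1)[OF that] sing by (simp add: algebra_simps)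
    note d = decomp[OF this]
    have sum: "int (length u) + int (length v) = n - fibnum (k - 1)"
      using d(1) len by simp
    show ?thesis
    proof (intro exI conjI)
      show "0 \<le> int (length u)" "int (length u) \<le> n - fibnum (k - 1)"
        using sum len by linarith+
      show "u = subword (S (K + 2)) (fibnum k - int (length u) + 1) (fibnum k)"
        by (rule sufI) (use d(2) sum len in \<open>(assumption | linarith)+\<close>)
      show "v = subword (S (K + 2)) 1 (n - fibnum (k - 1) - int (length u))"
        by (rule preI) (use d(4) sum len in \<open>(assumption | linarith)+\<close>)
    qed
  qed

  have c6: "\<exists>i. 0 \<le> i \<and> i \<le> fibnum (k + 1) - n - 2 \<and>
      u = subword (S (K + 1)) (fibnum (k + 1) - n - i) (fibnum (k - 1)) \<and>
      v = subword (S (K + 1)) 1 (fibnum (k - 1) - i - 1)" if t: "w \<in> T2 3"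
  proof -
    obtain m where m: "K = Suc m" using T2(2)[OF t] k by (cases K) auto
    have "sk w = S (Suc m)" using T2(1)[OF t] sing m by (simp add: algebra_simps)
    note d = decomp[OF this]
    have sum: "int (length u) + int (length v) = n - fibnum (k - 2)"
      using d(1) len m by simp
    have aff: "suffix u (S (K + 1))" "prefix v (S (K + 1))"
      and short: "length u < length (S (K + 1))" "length v < length (S (K + 1))"
      using d(2-5) m by simp_all
    show ?thesis
    proof (intro exI conjI)
      show "0 \<le> fibnum (k - 1) - 1 - int (length v)"
        "fibnum (k - 1) - 1 - int (length v) \<le> fibnum (k + 1) - n - 2"
        using sum len rec short by linarith+
      show "u = subword (S (K + 1)) (fibnum (k + 1) - n - (fibnum (k - 1) - 1 - int (length v))) (fibnum (k - 1))"
        by (rule sufI) (use aff(1) sum len rec short in \<open>(assumption | linarith)+\<close>)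
      show "v = subword (S (K + 1)) 1 (fibnum (k - 1) - (fibnum (k - 1) - 1 - int (length v)) - 1)"
        by (rule preI) (use aff(2) sum len rec short in \<open>(assumption | linarith)+\<close>)
    qed
  qed

  show ?thesis unfolding u_def[symmetric] v_def[symmetric] sing
    using c1 c2 c3 c4 c5 c6 by blast
qed

end
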